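(* Fix an integer $d\ge 3$. Let $(G_N)$ be a family of finite simple connected $d$-regular graphs, where $G_N$ has $N$ vertices and $N$ runs through an infinite set of positive integers, and fix an integer $j\ge 0$ such that the girth satisfies $g(G_N)\ge j+2$ for all sufficiently large $N$ in this set. Let $\beta_N=|E(G_N)|-|V(G_N)|+1$ be the cycle rank of $G_N$, and let $h_j(G_N)$ be the coefficient of $z^j$ in the $h$-polynomial of $\mathrm{BC}(G_N)$ (for any total ordering of $E(G_N)$). Then $$\beta_N=\left(\frac d2-1\right)N+1,$$ for all sufficiently large $N$, $$h_j(G_N)=\binom{\beta_N+j-1}{j},$$ and hence, as $N\to\infty$, $$h_j(G_N)\sim \frac1{j!}\left(\frac{d-2}{2}N\right)^j.$$ In particular, this applies to families $(G_N)$ of $d$-regular Ramanujan graphs satisfying this girth condition.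
   Context: The girth $g(G)$ is the length of a shortest cycle of $G$. A finite connected $d$-regular graph is Ramanujan if every eigenvalue $\theta$ of its adjacency matrix with $|\theta|\ne d$ satisfies $|\theta|\le 2\sqrt{d-1}$. The notation $a_N\sim b_N$ means $a_N/b_N\to 1$. For a finite connected loopless graph $G$ with a fixed total order on $E(G)$, a broken circuit is a set $C\setminus\{\max C\}$, where $C$ is the edge set of a cycle of $G$ and $\max C$ is its largest edge. The broken-circuit complex $\mathrm{BC}(G)$ is the simplicial complex on $E(G)$ whose faces are the edge sets containing no broken circuit. With $r=|V(G)|-1$ and $b_i$ the number of faces of $\mathrm{BC}(G)$ having exactly $i$ elements, the $h$-polynomial of $\mathrm{BC}(G)$ is $h_G(z)=\sum_{i=0}^{r}b_i z^i(1-z)^{r-i}$. *)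

theory Defs
  imports
    Complex_Main
    "HOL-Library.Extended_Nat"
    "HOL-Computational_Algebra.Polynomial"
    "Jordan_Normal_Form.Char_Poly"
begin

text \<open>Simple graphs are given by a vertex set and a set of edges, each edge being the set of its
  two endpoints.\<close>

record 'a ugraph =
  verts :: "'a set"
  edges :: "'a set set"

definition finite_simple_graph :: "'a ugraph \<Rightarrow> bool" where
  "finite_simple_graph G \<longleftrightarrow>
     finite (verts G) \<and> (\<forall>e\<in>edges G. e \<subseteq> verts G \<and> card e = 2)"

definition graph_connected :: "'a ugraph \<Rightarrow> bool" where
  "graph_connected G \<longleftrightarrow>
     verts G \<noteq> {} \<and> (\<forall>u\<in>verts G. \<forall>v\<in>verts G. (u, v) \<in> {(x, y). {x, y} \<in> edges G}\<^sup>*)"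

definition vertex_degree :: "'a ugraph \<Rightarrow> 'a \<Rightarrow> nat" where
  "vertex_degree G v = card {e \<in> edges G. v \<in> e}"

definition regular_graph :: "nat \<Rightarrow> 'a ugraph \<Rightarrow> bool" where
  "regular_graph d G \<longleftrightarrow> (\<forall>v\<in>verts G. vertex_degree G v = d)"

text \<open>A cycle is represented by the list of its vertices in cyclic order, without repeating the
  first vertex at the end; its length is then the length of the list. At least three vertices
  are required, as a cycle of a simple graph does not run back and forth along one edge.\<close>

definition cycle_edges :: "'a list \<Rightarrow> 'a set set" where
  "cycle_edges p = {{p ! i, p ! (Suc i mod length p)} | i. i < length p}"

definition is_cycle :: "'a ugraph \<Rightarrow> 'a list \<Rightarrow> bool" where
  "is_cycle G p \<longleftrightarrow> 3 \<le> length p \<and> distinct p \<and> cycle_edges p \<subseteq> edges G"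

text \<open>The girth of an acyclic graph is \<open>\<infinity>\<close>.\<close>

definition girth :: "'a ugraph \<Rightarrow> enat" where
  "girth G = (INF p\<in>{p. is_cycle G p}. enat (length p))"

definition cycle_rank :: "'a ugraph \<Rightarrow> int" where
  "cycle_rank G = int (card (edges G)) - int (card (verts G)) + 1"

text \<open>The matrix depends on the chosen enumeration \<open>vs\<close> of the vertices, its eigenvalues do not.
  As the matrix is real and symmetric, all its eigenvalues are real.\<close>

definition adjacency_matrix :: "'a ugraph \<Rightarrow> 'a list \<Rightarrow> real mat" where
  "adjacency_matrix G vs =
     mat (length vs) (length vs) (\<lambda>(i, k). if {vs ! i, vs ! k} \<in> edges G then 1 else 0)"

definition ramanujan_graph :: "nat \<Rightarrow> 'a ugraph \<Rightarrow> bool" where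
  "ramanujan_graph d G \<longleftrightarrow>
     finite_simple_graph G \<and> graph_connected G \<and> regular_graph d G \<and>
     (\<forall>vs. distinct vs \<and> set vs = verts G \<longrightarrow>
        (\<forall>\<theta>. eigenvalue (adjacency_matrix G vs) \<theta> \<and> \<bar>\<theta>\<bar> \<noteq> real d \<longrightarrow>
             \<bar>\<theta>\<bar> \<le> 2 * sqrt (real d - 1)))"

text \<open>Below, \<open>r\<close> is a total order on the edges, \<open>(e, f) \<in> r\<close> meaning \<open>e \<le> f\<close>.\<close>

definition broken_circuit :: "'a ugraph \<Rightarrow> 'a set rel \<Rightarrow> 'a set set \<Rightarrow> bool" where
  "broken_circuit G r B \<longleftrightarrow>
     (\<exists>p m. is_cycle G p \<and> m \<in> cycle_edges p \<and> (\<forall>e\<in>cycle_edges p. (e, m) \<in> r) \<and>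
            B = cycle_edges p - {m})"

definition bc_complex :: "'a ugraph \<Rightarrow> 'a set rel \<Rightarrow> 'a set set set" where
  "bc_complex G r = {F. F \<subseteq> edges G \<and> (\<forall>B. broken_circuit G r B \<longrightarrow> \<not> B \<subseteq> F)}"

definition bc_face_count :: "'a ugraph \<Rightarrow> 'a set rel \<Rightarrow> nat \<Rightarrow> nat" where
  "bc_face_count G r i = card {F \<in> bc_complex G r. card F = i}"

definition bc_h_poly :: "'a ugraph \<Rightarrow> 'a set rel \<Rightarrow> int poly" where
  "bc_h_poly G r =
     (let k = card (verts G) - 1
      in \<Sum>i=0..k. Polynomial.smult (int (bc_face_count G r i)) ([:0, 1:] ^ i * [:1, -1:] ^ (k - i)))"

definition bc_h :: "'a ugraph \<Rightarrow> 'a set rel \<Rightarrow> nat \<Rightarrow> int" where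
  "bc_h G r j = poly.coeff (bc_h_poly G r) j"

text \<open>The filter describing \<open>N \<rightarrow> \<infinity>\<close> with \<open>N\<close> restricted to the index set \<open>S\<close>. It is nontrivial
  precisely if \<open>S\<close> is infinite.\<close>

abbreviation at_top_in :: "nat set \<Rightarrow> nat filter" where
  "at_top_in S \<equiv> inf at_top (principal S)"

end

theory Submission
  imports Defs "HOL-Computational_Algebra.Formal_Power_Series"
begin

text \<open>A broken circuit has at least \<open>girth G - 1 \<ge> j + 1\<close> edges, so every set of at most \<open>j\<close>
  edges is a face and \<open>b\<^sub>i = |E| choose i\<close> for \<open>i \<le> j\<close>. Modulo \<open>z\<^sup>j\<^sup>+\<^sup>1\<close> the \<open>h\<close>-polynomial is
  therefore \<open>(1 - z)\<close> to the power \<open>r - |E| = - \<beta>\<close>; on coefficients this is Vandermonde's identity.\<close>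

text \<open>If the edges at two positions \<open>i\<close> and \<open>k\<close> coincide with their
  ends swapped, each position is the cyclic successor of the other, so the length divides 2. This is
  excluded by \<open>3 \<le> length p\<close>.\<close>

lemma card_cycle_edges:
  assumes "3 \<le> length p" "distinct p"
  shows "card (cycle_edges p) = length p"
proof -
  let ?n = "length p"
  have "inj_on (\<lambda>i. {p ! i, p ! (Suc i mod ?n)}) {..<?n}"
  proof (rule inj_onI)
    fix i k assume ik: "i \<in> {..<?n}" "k \<in> {..<?n}"
      and eq: "{p ! i, p ! (Suc i mod ?n)} = {p ! k, p ! (Suc k mod ?n)}"
    have pos: "0 < ?n" using assms(1) by linarith
    have "p ! i = p ! k \<or> p ! i = p ! (Suc k mod ?n) \<and> p ! (Suc i mod ?n) = p ! k"
      using eq by (auto simp: doubleton_eq_iff)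
    then have "i = k \<or> i = Suc k mod ?n \<and> Suc i mod ?n = k"
      using ik pos assms(2) by (simp add: nth_eq_iff_index_eq)
    then show "i = k"
      using ik assms(1) by (auto simp: mod_Suc split: if_splits)
  qed
  moreover have "cycle_edges p = (\<lambda>i. {p ! i, p ! (Suc i mod ?n)}) ` {..<?n}"
    by (auto simp: cycle_edges_def)
  ultimately show ?thesis by (simp add: card_image)
qed

lemma finite_edges:
  assumes "finite_simple_graph G"
  shows "finite (edges G)"
proof (rule finite_subset)
  show "edges G \<subseteq> Pow (verts G)"
    using assms by (auto simp: finite_simple_graph_def)
qed (use assms in \<open>simp add: finite_simple_graph_def\<close>)

lemma card_broken_circuit:
  assumes "girth G \<ge> enat (j + 2)" "broken_circuit G r B"
  shows "j < card B"
proof -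
  obtain p m where p: "is_cycle G p" "m \<in> cycle_edges p" "B = cycle_edges p - {m}"
    using assms(2) by (auto simp: broken_circuit_def)
  then have "girth G \<le> enat (length p)"
    unfolding girth_def by (intro INF_lower) simp
  then have len: "j + 2 \<le> length p"
    using assms(1) order_trans enat_ord_simps(1) by blast
  have card: "card (cycle_edges p) = length p"
    using p(1) by (simp add: card_cycle_edges is_cycle_def)
  \<comment> \<open>\<open>G\<close> is not assumed finite here. Since \<open>card\<close> is 0 on
    infinite sets, the positive cardinality yields finiteness, so that removing \<open>m\<close>
    lowers \<open>card\<close> by exactly one.\<close>
  then have "finite (cycle_edges p)"
    using len by (intro card_ge_0_finite) linarith
  then show ?thesis
    using p card len by auto
qed

lemma bc_face_count_below_girth:
  assumes "finite_simple_graph G" "girth G \<ge> enat (j + 2)" "i \<le> j"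
  shows "bc_face_count G r i = card (edges G) choose i"
proof -
  have fin: "finite (edges G)" using assms(1) by (rule finite_edges)
  have "\<not> B \<subseteq> F" if "broken_circuit G r B" "F \<subseteq> edges G" "card F = i" for B F
    using card_broken_circuit[OF assms(2) that(1)] that assms(3)
      card_mono[OF finite_subset[OF that(2) fin], of B] by auto
  then have "{F \<in> bc_complex G r. card F = i} = {F. F \<subseteq> edges G \<and> card F = i}"
    by (auto simp: bc_complex_def)
  then show ?thesis
    by (simp add: bc_face_count_def n_subsets[OF fin])
qed

lemma coeff_one_minus_X_power:
  "poly.coeff ([:1, -1:] ^ n) k = (-1) ^ k * (of_nat (n choose k) :: 'a :: comm_ring_1)"
proof (induction n arbitrary: k)
  case 0
  show ?case by (cases k) simp_all
next
  case (Suc n)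
  show ?case by (cases k) (simp_all add: Suc algebra_simps)
qed

lemma coeff_X_power_mult:
  "poly.coeff ([:0, 1:] ^ i * q) j = (if j < i then 0 else poly.coeff q (j - i) :: 'a :: comm_ring_1)"
proof (induction i arbitrary: j)
  case (Suc i)
  show ?case by (cases j) (simp_all add: Suc mult.assoc)
qed simp

text \<open>The binomial is generalized because Vandermonde's identity is applied with a negative
  upper entry. The bound \<open>j < card (verts G)\<close> keeps the degree \<open>j\<close> within
  the range of the sum and the natural subtractions free of truncation.\<close>

lemma bc_h_below_girth:
  assumes "finite_simple_graph G" "girth G \<ge> enat (j + 2)" "j < card (verts G)"
  shows "real_of_int (bc_h G r j) = (real_of_int (cycle_rank G) + real j - 1) gchoose j"
proof -
  define m where "m = card (edges G)"
  define k where "k = card (verts G) - 1"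
  have jk: "j \<le> k" using assms(3) by (simp add: k_def)
  have "bc_h G r j = (\<Sum>i=0..k. int (bc_face_count G r i) *
      (if j < i then 0 else (-1) ^ (j - i) * int ((k - i) choose (j - i))))"
    unfolding bc_h_def bc_h_poly_def Let_def k_def[symmetric]
    by (simp add: coeff_sum coeff_X_power_mult coeff_one_minus_X_power cong: if_cong)
  \<comment> \<open>Terms with \<open>i > j\<close> vanish, being multiples of \<open>z^i\<close>;
    since \<open>j \<le> k\<close>, no index up to \<open>j\<close> is missing.\<close>
  also have "\<dots> = (\<Sum>i=0..j. int (bc_face_count G r i) * ((-1) ^ (j - i) * int ((k - i) choose (j - i))))"
    using jk by (intro sum.mono_neutral_cong_right) auto
  finally have "real_of_int (bc_h G r j) = (\<Sum>i=0..j. real (bc_face_count G r i) *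
      ((-1) ^ (j - i) * real ((k - i) choose (j - i))))"
    by simp
  also have "\<dots> = (\<Sum>i=0..j. (real m gchoose i) * ((real j - real k - 1) gchoose (j - i)))"
  proof (rule sum.cong[OF refl])
    fix i assume "i \<in> {0..j}"
    then have i: "i \<le> j" by simp
    \<comment> \<open>Negating the upper entry \<open>k - i\<close> gives
      \<open>(j - i) - (k - i) - 1 = j - k - 1\<close>. This no longer depends on \<open>i\<close>,
      so the sum becomes a Vandermonde convolution.\<close>
    have "(real j - real k - 1) gchoose (j - i) = (-1) ^ (j - i) * (real (k - i) gchoose (j - i))"
      using i jk by (subst gbinomial_negated_upper) (simp add: of_nat_diff algebra_simps)
    then show "real (bc_face_count G r i) * ((-1) ^ (j - i) * real ((k - i) choose (j - i))) =
        (real m gchoose i) * ((real j - real k - 1) gchoose (j - i))"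
      using bc_face_count_below_girth[OF assms(1,2) i] by (simp add: m_def binomial_gbinomial)
  qed
  also have "\<dots> = (real m + (real j - real k - 1)) gchoose j"
    by (rule gbinomial_Vandermonde)
  also have "real m + (real j - real k - 1) = real_of_int (cycle_rank G) + real j - 1"
    using assms(3) by (simp add: cycle_rank_def m_def k_def of_nat_diff)
  finally show ?thesis .
qed

text \<open>Handshake argument: incident pairs of a vertex and an edge are counted once by vertices
  and once by edges.\<close>

lemma regular_graph_edge_count:
  assumes "finite_simple_graph G" "regular_graph d G"
  shows "d * card (verts G) = 2 * card (edges G)"
proof -
  have fin: "finite (verts G)" and e: "\<And>e. e \<in> edges G \<Longrightarrow> e \<subseteq> verts G \<and> card e = 2"
    using assms(1) by (auto simp: finite_simple_graph_def)
  have "{v \<in> verts G. v \<in> e} = e" if "e \<in> edges G" for e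
    using e[OF that] by auto
  then have "(\<Sum>v\<in>verts G. card {e \<in> edges G. v \<in> e}) = 2 * card (edges G)"
    using e by (intro sum_multicount[OF fin finite_edges[OF assms(1)]]) auto
  moreover have "(\<Sum>v\<in>verts G. card {e \<in> edges G. v \<in> e}) = d * card (verts G)"
    using assms(2) by (simp add: regular_graph_def vertex_degree_def)
  ultimately show ?thesis by simp
qed

lemma regular_graph_cycle_rank:
  assumes "finite_simple_graph G" "regular_graph d G"
  shows "real_of_int (cycle_rank G) = (real d / 2 - 1) * real (card (verts G)) + 1"
proof -
  have "real d * real (card (verts G)) = 2 * real (card (edges G))"
    using regular_graph_edge_count[OF assms] by (metis of_nat_mult of_nat_numeral)
  then show ?thesis by (simp add: cycle_rank_def field_simps)
qed

text \<open>Dividing each of the \<open>j\<close> factors of the numerator by \<open>c * n\<close>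
  leaves \<open>1 + (i + 1) / (c * n)\<close>, which tends to 1, and the number of factors is fixed.
  It is applied with \<open>c = (d - 2) / 2\<close>, where \<open>c * N + j\<close> is the cycle
  rank plus \<open>j - 1\<close>.\<close>

lemma gbinomial_linear_asymptotics:
  fixes c :: real
  assumes "c > 0"
  shows "(\<lambda>n. ((c * real n + real j) gchoose j) / (1 / fact j * (c * real n) ^ j)) \<longlonglongrightarrow> 1"
proof -
  have "(\<lambda>n. \<Prod>i<j. 1 + real (Suc i) / (c * real n)) \<longlonglongrightarrow> (\<Prod>i<j. 1 + 0)"
    using assms by (intro tendsto_prod tendsto_add tendsto_const tendsto_divide_0[OF tendsto_const]
        filterlim_at_top_imp_at_infinity filterlim_tendsto_pos_mult_at_top[OF tendsto_const]
        filterlim_real_sequentially)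
  then have lim: "(\<lambda>n. \<Prod>i<j. 1 + real (Suc i) / (c * real n)) \<longlonglongrightarrow> 1" by simp
  have "(\<Prod>i<j. 1 + real (Suc i) / (c * real n)) =
      ((c * real n + real j) gchoose j) / (1 / fact j * (c * real n) ^ j)" if "n > 0" for n
  proof -
    \<comment> \<open>As a rising factorial the numerator starts at
      \<open>(c * n + j) - j + 1 = c * n + 1\<close>, whence \<open>Suc i\<close>.\<close>
    have "((c * real n + real j) gchoose j) = (\<Prod>i<j. c * real n + real (Suc i)) / fact j"
      by (simp add: gbinomial_pochhammer' pochhammer_prod lessThan_atLeast0 add_ac)
    moreover have "(\<Prod>i<j. 1 + real (Suc i) / (c * real n)) =
        (\<Prod>i<j. (c * real n + real (Suc i)) / (c * real n))"
      using that assms by (intro prod.cong) (auto simp: field_simps)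
    ultimately show ?thesis by (simp add: prod_dividef)
  qed
  then have "\<forall>\<^sub>F n in sequentially. (\<Prod>i<j. 1 + real (Suc i) / (c * real n)) =
      ((c * real n + real j) gchoose j) / (1 / fact j * (c * real n) ^ j)"
    by (rule eventually_mono[OF eventually_gt_at_top[of 0]])
  then show ?thesis using lim by (rule Lim_transform_eventually[rotated])
qed

text \<open>Collects the three conclusions under conditions shared by general families and Ramanujan
  families, so that it proves both halves of the theorem.\<close>

lemma bc_h_regular_family:
  fixes G :: "nat \<Rightarrow> 'a ugraph" and ord :: "nat \<Rightarrow> 'a set rel"
  assumes "d \<ge> 3"
    and graph: "\<And>N. N \<in> S \<Longrightarrow> finite_simple_graph (G N) \<and> regular_graph d (G N) \<and> card (verts (G N)) = N"
    and girth: "\<forall>\<^sub>F N in at_top_in S. girth (G N) \<ge> enat (j + 2)"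
  shows "\<forall>N\<in>S. real_of_int (cycle_rank (G N)) = (real d / 2 - 1) * real N + 1"
    and "\<forall>\<^sub>F N in at_top_in S. bc_h (G N) (ord N) j = int (nat (cycle_rank (G N) + int j - 1) choose j)"
    and "((\<lambda>N. real_of_int (bc_h (G N) (ord N) j) /
        (1 / fact j * ((real d - 2) / 2 * real N) ^ j)) \<longlongrightarrow> 1) (at_top_in S)"
proof -
  show rank: "\<forall>N\<in>S. real_of_int (cycle_rank (G N)) = (real d / 2 - 1) * real N + 1"
    using graph regular_graph_cycle_rank by metis
  have "\<forall>\<^sub>F N in at_top_in S. N \<in> S \<and> j < N \<and> girth (G N) \<ge> enat (j + 2)"
    using girth eventually_gt_at_top[of j] unfolding eventually_inf_principal
    by eventually_elim simp
  then have h: "\<forall>\<^sub>F N in at_top_in S. N \<in> S \<and>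
      real_of_int (bc_h (G N) (ord N) j) = (real_of_int (cycle_rank (G N)) + real j - 1) gchoose j"
    by (rule eventually_mono) (use graph bc_h_below_girth in metis)
  show "\<forall>\<^sub>F N in at_top_in S. bc_h (G N) (ord N) j = int (nat (cycle_rank (G N) + int j - 1) choose j)"
    using h
  proof (rule eventually_mono, elim conjE)
    fix N assume N: "N \<in> S"
      "real_of_int (bc_h (G N) (ord N) j) = (real_of_int (cycle_rank (G N)) + real j - 1) gchoose j"
    \<comment> \<open>The cycle rank is at least 1 because \<open>d / 2 - 1\<close> is positive.
      Hence the argument of \<open>nat\<close> is nonnegative, even for \<open>j = 0\<close>, and
      the generalized binomial is an ordinary one.\<close>
    have "real_of_int (cycle_rank (G N)) \<ge> 1"
      using rank N(1) \<open>d \<ge> 3\<close> by simp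
    then have "real (nat (cycle_rank (G N) + int j - 1)) = real_of_int (cycle_rank (G N)) + real j - 1"
      by simp
    then have "real_of_int (bc_h (G N) (ord N) j) = real (nat (cycle_rank (G N) + int j - 1) choose j)"
      using N(2) by (simp add: binomial_gbinomial)
    then show "bc_h (G N) (ord N) j = int (nat (cycle_rank (G N) + int j - 1) choose j)"
      by linarith
  qed
  let ?c = "(real d - 2) / 2"
  \<comment> \<open>A limit along all natural numbers persists along the finer filter
    \<open>at_top_in S\<close>.\<close>
  have "((\<lambda>N. ((?c * real N + real j) gchoose j) / (1 / fact j * (?c * real N) ^ j)) \<longlongrightarrow> 1) (at_top_in S)"
    using gbinomial_linear_asymptotics[of ?c j] \<open>d \<ge> 3\<close> by (intro tendsto_mono[OF inf_le1]) auto
  moreover have "\<forall>\<^sub>F N in at_top_in S.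
      ((?c * real N + real j) gchoose j) / (1 / fact j * (?c * real N) ^ j) =
      real_of_int (bc_h (G N) (ord N) j) / (1 / fact j * (?c * real N) ^ j)"
    using h
  proof (rule eventually_mono, elim conjE)
    fix N assume N: "N \<in> S"
      "real_of_int (bc_h (G N) (ord N) j) = (real_of_int (cycle_rank (G N)) + real j - 1) gchoose j"
    have "real_of_int (cycle_rank (G N)) + real j - 1 = ?c * real N + real j"
      using rank N(1) by (simp add: field_simps)
    then show "((?c * real N + real j) gchoose j) / (1 / fact j * (?c * real N) ^ j) =
        real_of_int (bc_h (G N) (ord N) j) / (1 / fact j * (?c * real N) ^ j)"
      by (simp only: N(2))
  qed
  ultimately show "((\<lambda>N. real_of_int (bc_h (G N) (ord N) j) /
      (1 / fact j * (?c * real N) ^ j)) \<longlongrightarrow> 1) (at_top_in S)"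
    by (rule Lim_transform_eventually)
qed

theorem corollary8p2:
  fixes d j :: nat
  assumes "d \<ge> 3"
  shows
    "(\<forall>(S :: nat set) (G :: nat \<Rightarrow> 'a ugraph) (ord :: nat \<Rightarrow> 'a set rel).
        infinite S \<and> S \<subseteq> {0<..} \<and>
        (\<forall>N\<in>S. finite_simple_graph (G N) \<and> graph_connected (G N) \<and> regular_graph d (G N) \<and>
               card (verts (G N)) = N \<and> linear_order_on (edges (G N)) (ord N)) \<and>
        (\<forall>\<^sub>F N in at_top_in S. girth (G N) \<ge> enat (j + 2)) \<longrightarrow>
        (\<forall>N\<in>S. real_of_int (cycle_rank (G N)) = (real d / 2 - 1) * real N + 1) \<and>
        (\<forall>\<^sub>F N in at_top_in S. bc_h (G N) (ord N) j = int (nat (cycle_rank (G N) + int j - 1) choose j)) \<and>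
        ((\<lambda>N. real_of_int (bc_h (G N) (ord N) j) /
              (1 / fact j * ((real d - 2) / 2 * real N) ^ j)) \<longlongrightarrow> 1) (at_top_in S))
     \<and>
     (\<forall>(S :: nat set) (G :: nat \<Rightarrow> 'a ugraph) (ord :: nat \<Rightarrow> 'a set rel).
        infinite S \<and> S \<subseteq> {0<..} \<and>
        (\<forall>N\<in>S. ramanujan_graph d (G N) \<and>
               card (verts (G N)) = N \<and> linear_order_on (edges (G N)) (ord N)) \<and>
        (\<forall>\<^sub>F N in at_top_in S. girth (G N) \<ge> enat (j + 2)) \<longrightarrow>
        (\<forall>N\<in>S. real_of_int (cycle_rank (G N)) = (real d / 2 - 1) * real N + 1) \<and>
        (\<forall>\<^sub>F N in at_top_in S. bc_h (G N) (ord N) j = int (nat (cycle_rank (G N) + int j - 1) choose j)) \<and>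
        ((\<lambda>N. real_of_int (bc_h (G N) (ord N) j) /
              (1 / fact j * ((real d - 2) / 2 * real N) ^ j)) \<longlongrightarrow> 1) (at_top_in S))"
  by (intro conjI allI impI; elim conjE; rule bc_h_regular_family[OF assms];
      (assumption | simp add: ramanujan_graph_def))

end
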